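(* Player $II$ has a winning strategy in the cut and choose game $G_1(\mathcal{PC})$.
   Context: Ideals on a countable set contain all finite subsets; for an ideal $\mathcal{I}$, $\mathcal{I}^+$ denotes the family of sets not in $\mathcal{I}$. Cut and choose game $G_1(\mathcal{I})$ for an ideal $\mathcal{I}$ on $\omega$: in the first move player $I$ partitions $\omega=A^0_0\cup A^0_1$ and player $II$ answers with $i_0\in 2$ and $n_0\in A^0_{i_0}$; in move $m+1$ player $I$ partitions the previously chosen piece $A^{m}_{i_{m}}$ into two pieces $A^{m+1}_0\cup A^{m+1}_1$ and player $II$ answers with $i_{m+1}\in 2$ and $n_{m+1}\in A^{m+1}_{i_{m+1}}$. Player $I$ wins if $\{n_j:j\in\omega\}\in\mathcal{I}$; otherwise player $II$ wins. Fix a family $\{A_s\subseteq\omega: s\in\omega^{<\omega}\}$ such that $A_\emptyset=\omega$, every $A_s$ is infinite, $\{A_{s^\frown n}:n\in\omega\}$ is a partition of $A_s$, and for distinct $n,m\in\omega$ there exist $s\neq t$ in $\omega^{<\omega}$ with $n\in A_s$, $m\in A_t$. For $A\subseteq\omega$ let $T_A=\{s\in\omega^{<\omega}: A\cap A_s\neq\emptyset\}$. A tree $T\subseteq\omega^{<\omega}$ is small-branching if for every $s\in T$, $|\{n\in\omega: s^\frown n\in T\}|\le |s|+1$. Let $\mathcal{S}_0=\{A\subseteq\omega: \exists s\in\omega^{<\omega}\,(A\subseteq A_s\wedge \forall n\in\omega\ |A\cap A_{s^\frown n}|=1)\}$, $\mathcal{S}_1=\{A\subseteq\omega: T_A \text{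 is small-branching}\}$, and let $\mathcal{PC}$ be the ideal on $\omega$ generated by $\mathcal{S}_0\cup\mathcal{S}_1$ (and the finite sets). *)

theory Defs
  imports Main "HOL.Hull" "HOL-Library.Disjoint_Sets"
begin

section \<open>Ideals on the natural numbers\<close>

text \<open>Properness is not part of the definition, so that every family of sets generates an ideal.\<close>

definition is_ideal :: "nat set set \<Rightarrow> bool" where
  "is_ideal I \<longleftrightarrow>
     (\<forall>F. finite F \<longrightarrow> F \<in> I) \<and>
     (\<forall>X Y. X \<in> I \<longrightarrow> Y \<subseteq> X \<longrightarrow> Y \<in> I) \<and>
     (\<forall>X Y. X \<in> I \<longrightarrow> Y \<in> I \<longrightarrow> X \<union> Y \<in> I)"

definition generated_ideal :: "nat set set \<Rightarrow> nat set set" where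
  "generated_ideal S = is_ideal hull S"

lemma is_ideal_generated_ideal: "is_ideal (generated_ideal S)"
  unfolding generated_ideal_def by (rule hull_in) (auto simp: is_ideal_def)

section \<open>The cut and choose game\<close>

text \<open>
  A move of player I is a pair of pieces, indexed by \<^typ>\<open>bool\<close> in the role of the set 2; pieces may be
  empty. A move of player II is an index together with a number.
\<close>

type_synonym cut = "bool \<Rightarrow> nat set"
type_synonym choice = "bool \<times> nat"

definition is_cut :: "nat set \<Rightarrow> cut \<Rightarrow> bool" where
  "is_cut B C \<longleftrightarrow> C False \<union> C True = B \<and> C False \<inter> C True = {}"

text \<open>The set that player I has to partition in a given move.\<close>

fun board :: "(nat \<Rightarrow> cut) \<Rightarrow> (nat \<Rightarrow> choice) \<Rightarrow> nat \<Rightarrow> nat set" where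
  "board C c 0 = UNIV"
| "board C c (Suc m) = C m (fst (c m))"

definition legal_I :: "(nat \<Rightarrow> cut) \<Rightarrow> (nat \<Rightarrow> choice) \<Rightarrow> nat \<Rightarrow> bool" where
  "legal_I C c m \<longleftrightarrow> is_cut (board C c m) (C m)"

definition legal_II :: "(nat \<Rightarrow> cut) \<Rightarrow> (nat \<Rightarrow> choice) \<Rightarrow> nat \<Rightarrow> bool" where
  "legal_II C c m \<longleftrightarrow> snd (c m) \<in> C m (fst (c m))"

text \<open>A strategy of player II sees all completed rounds and the current move of player I.\<close>

type_synonym strategy_II = "(cut \<times> choice) list \<Rightarrow> cut \<Rightarrow> choice"

definition follows_II :: "strategy_II \<Rightarrow> (nat \<Rightarrow> cut) \<Rightarrow> (nat \<Rightarrow> choice) \<Rightarrow> bool" where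
  "follows_II \<sigma> C c \<longleftrightarrow> (\<forall>m. c m = \<sigma> (map (\<lambda>k. (C k, c k)) [0..<m]) (C m))"

text \<open>
  Player II must answer legally as long as player I has played legally, and must win every
  infinite run in which player I plays legally throughout.
\<close>

definition winning_strategy_II :: "nat set set \<Rightarrow> strategy_II \<Rightarrow> bool" where
  "winning_strategy_II I \<sigma> \<longleftrightarrow>
     (\<forall>C c. follows_II \<sigma> C c \<longrightarrow>
        (\<forall>m. (\<forall>k\<le>m. legal_I C c k) \<longrightarrow> legal_II C c m) \<and>
        ((\<forall>m. legal_I C c m) \<longrightarrow> {snd (c j) | j. True} \<notin> I))"

section \<open>The ideal PC\<close>

text \<open>
  The family is indexed by finite sequences, rendered as lists. The last clause is the literal
  separation condition. It does not require \<open>s\<close> and \<open>t\<close> to have the same length, so it holds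
  for every family that separates points in that stronger sense (and in fact already follows from
  the other clauses).
\<close>

definition partition_scheme :: "(nat list \<Rightarrow> nat set) \<Rightarrow> bool" where
  "partition_scheme A \<longleftrightarrow>
     A [] = UNIV \<and>
     (\<forall>s. infinite (A s)) \<and>
     (\<forall>s. disjoint_family (\<lambda>n. A (s @ [n])) \<and> (\<Union>n. A (s @ [n])) = A s) \<and>
     (\<forall>n m. n \<noteq> m \<longrightarrow> (\<exists>s t. s \<noteq> t \<and> n \<in> A s \<and> m \<in> A t))"

definition tree_of :: "(nat list \<Rightarrow> nat set) \<Rightarrow> nat set \<Rightarrow> nat list set" where
  "tree_of A X = {s. X \<inter> A s \<noteq> {}}"

text \<open>Finiteness is stated separately because \<^const>\<open>card\<close> is 0 on infinite sets.\<close>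

definition small_branching :: "nat list set \<Rightarrow> bool" where
  "small_branching T \<longleftrightarrow>
     (\<forall>s\<in>T. finite {n. s @ [n] \<in> T} \<and> card {n. s @ [n] \<in> T} \<le> length s + 1)"

definition S0 :: "(nat list \<Rightarrow> nat set) \<Rightarrow> nat set set" where
  "S0 A = {X. \<exists>s. X \<subseteq> A s \<and> (\<forall>n. card (X \<inter> A (s @ [n])) = 1)}"

definition S1 :: "(nat list \<Rightarrow> nat set) \<Rightarrow> nat set set" where
  "S1 A = {X. small_branching (tree_of A X)}"

definition PC :: "(nat list \<Rightarrow> nat set) \<Rightarrow> nat set set" where
  "PC A = generated_ideal (S0 A \<union> S1 A)"

end

theory Submission
  imports Defs
begin

text \<open>
  Every set in \<^term>\<open>PC A\<close> is met by only \<open>O(\<bar>s\<bar> + 1)\<close> children of each sufficiently long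
  node \<open>s\<close>. Player II defeats this bound along a single branch. Call \<open>X\<close> alive at \<open>s\<close> if it survives the
  well-founded removal of nodes with only finitely many remaining children; being alive at a fixed \<open>s\<close>
  is partition regular. Player II keeps the board alive at a current node \<open>s\<close>, picks
  numbers below ever new live children of \<open>s\<close>, and after about \<open>3 \<bar>s\<bar>\<^sup>2\<close> picks moves the
  current node to a live child. No cut made by player I can prevent that move, because the board need not
  be contained in \<^term>\<open>A s\<close>.
\<close>

section \<open>A linear growth bound on sets in PC\<close>

definition children :: "(nat list \<Rightarrow> nat set) \<Rightarrow> nat set \<Rightarrow> nat list \<Rightarrow> nat set" where
  "children A X s = {n. s @ [n] \<in> tree_of A X}"

text \<open>The threshold \<open>N\<close> is needed because a set in \<open>S0\<close> has
  infinitely many children at its own witness node. The free factor \<open>K\<close> makes the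
  notion stable under unions.\<close>

definition linearly_branching :: "(nat list \<Rightarrow> nat set) \<Rightarrow> nat set \<Rightarrow> bool" where
  "linearly_branching A X \<longleftrightarrow>
     (\<exists>K N. \<forall>s. N \<le> length s \<longrightarrow>
        finite (children A X s) \<and> card (children A X s) \<le> K * (length s + 1))"

lemma linearly_branchingI:
  assumes "\<And>s. N \<le> length s \<Longrightarrow>
    finite (children A X s) \<and> card (children A X s) \<le> K * (length s + 1)"
  shows "linearly_branching A X"
  using assms unfolding linearly_branching_def by blast

lemma partition_scheme_disjoint:
  assumes "partition_scheme A" "x \<in> A (s @ [n])" "x \<in> A (s @ [m])"
  shows "n = m"
  using assms unfolding partition_scheme_def disjoint_family_on_def by blast

lemma partition_scheme_child_subset:
  assumes "partition_scheme A"
  shows "A (s @ [n]) \<subseteq> A s"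
  using assms unfolding partition_scheme_def by blast

lemma partition_scheme_antimono:
  assumes "partition_scheme A"
  shows "A (s @ t) \<subseteq> A s"
proof (induction t rule: rev_induct)
  case (snoc n t)
  then show ?case
    using partition_scheme_child_subset[OF assms, of "s @ t" n] by auto
qed simp

lemma partition_scheme_same_length:
  assumes "partition_scheme A" "length s = length t" "x \<in> A s" "x \<in> A t"
  shows "s = t"
  using assms(2-)
proof (induction s arbitrary: t rule: rev_induct)
  case (snoc n s)
  then obtain t' m where t: "t = t' @ [m]"
    by (cases t rule: rev_cases) auto
  moreover have "s = t'"
    using snoc t partition_scheme_child_subset[OF assms(1)] by fastforce
  ultimately show ?case
    using snoc.prems partition_scheme_disjoint[OF assms(1)] by blast
qed simp

lemma card_children_le:
  assumes "partition_scheme A" "finite (X \<inter> A s)"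
  shows "finite (children A X s) \<and> card (children A X s) \<le> card (X \<inter> A s)"
proof -
  have "\<exists>x. n \<in> children A X s \<longrightarrow> x \<in> X \<inter> A (s @ [n])" for n
    unfolding children_def tree_of_def by blast
  then obtain f where f: "\<And>n. n \<in> children A X s \<Longrightarrow> f n \<in> X \<inter> A (s @ [n])"
    by metis
  have "inj_on f (children A X s)"
    using f partition_scheme_disjoint[OF assms(1)] by (metis IntD2 inj_onI)
  moreover have "f ` children A X s \<subseteq> X \<inter> A s"
    using f partition_scheme_child_subset[OF assms(1)] by blast
  ultimately show ?thesis
    using assms(2) by (metis card_inj_on_le finite_imageD finite_subset)
qed

lemma finite_linearly_branching:
  assumes "partition_scheme A" "finite X"
  shows "linearly_branching A X"
proof (rule linearly_branchingI[where N = 0 and K = "card X"])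
  fix s :: "nat list"
  have "card (X \<inter> A s) \<le> card X * (length s + 1)"
    using card_mono[OF assms(2), of "X \<inter> A s"] by (simp add: trans_le_add1)
  then show "finite (children A X s) \<and> card (children A X s) \<le> card X * (length s + 1)"
    using card_children_le[OF assms(1), of X s] assms(2) by auto
qed

text \<open>Let \<open>t\<close> witness membership in \<open>S0\<close>. A node longer than
  \<open>t\<close> either lies below a child of \<open>t\<close>, where \<open>X\<close> has a
  single point, or does not extend \<open>t\<close>, and then its set misses
  \<open>X\<close>.\<close>

lemma S0_linearly_branching:
  assumes "partition_scheme A" "X \<in> S0 A"
  shows "linearly_branching A X"
proof -
  obtain t where t: "X \<subseteq> A t" "\<And>n. card (X \<inter> A (t @ [n])) = 1"
    using assms(2) unfolding S0_def by blast
  show ?thesis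
  proof (rule linearly_branchingI[where N = "length t + 1" and K = 1])
    fix s :: "nat list"
    assume s: "length t + 1 \<le> length s"
    define u where "u = take (length t) s"
    define n where "n = s ! length t"
    have split: "s = (u @ [n]) @ drop (length t + 1) s"
      using s by (simp add: u_def n_def take_Suc_conv_app_nth[symmetric])
    have "A s \<subseteq> A (u @ [n])"
      using partition_scheme_antimono[OF assms(1)] split by metis
    moreover have "X \<inter> A (u @ [n]) \<subseteq> X \<inter> A (t @ [n])"
    proof
      fix x assume x: "x \<in> X \<inter> A (u @ [n])"
      then have "u = t"
        using partition_scheme_same_length[OF assms(1), of u t x] t(1) s
          partition_scheme_child_subset[OF assms(1)] by (auto simp: u_def)
      then show "x \<in> X \<inter> A (t @ [n])" using x by simp
    qed
    ultimately have sub: "X \<inter> A s \<subseteq> X \<inter> A (t @ [n])" by blast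
    have "finite (X \<inter> A (t @ [n]))"
      using t(2)[of n] by (metis card.infinite zero_neq_one)
    then have "finite (X \<inter> A s)" "card (X \<inter> A s) \<le> 1"
      using sub t(2)[of n] finite_subset card_mono by metis+
    then show "finite (children A X s) \<and> card (children A X s) \<le> 1 * (length s + 1)"
      using card_children_le[OF assms(1), of X s] by simp
  qed
qed

lemma S1_linearly_branching:
  assumes "partition_scheme A" "X \<in> S1 A"
  shows "linearly_branching A X"
proof (rule linearly_branchingI[where N = 0 and K = 1])
  fix s :: "nat list"
  \<comment> \<open>\<open>small_branching\<close> bounds only the nodes of the tree; all others
    have no children.\<close>
  have "children A X s = {}" if "s \<notin> tree_of A X"
    using that partition_scheme_child_subset[OF assms(1)] unfolding children_def tree_of_def by blast
  then show "finite (children A X s) \<and> card (children A X s) \<le> 1 * (length s + 1)"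
    using assms(2) by (cases "s \<in> tree_of A X") (auto simp: S1_def small_branching_def children_def)
qed

lemma linearly_branching_subset:
  assumes "linearly_branching A X" "Y \<subseteq> X"
  shows "linearly_branching A Y"
proof -
  obtain K N where KN: "\<And>s. N \<le> length s \<Longrightarrow>
      finite (children A X s) \<and> card (children A X s) \<le> K * (length s + 1)"
    using assms(1) unfolding linearly_branching_def by blast
  have sub: "children A Y s \<subseteq> children A X s" for s
    using assms(2) unfolding children_def tree_of_def by blast
  show ?thesis
    by (rule linearly_branchingI[where N = N and K = K])
      (meson KN sub card_mono finite_subset le_trans)
qed

lemma linearly_branching_Un:
  assumes "linearly_branching A X" "linearly_branching A Y"
  shows "linearly_branching A (X \<union> Y)"
proof -
  obtain K N where KN: "\<And>s. N \<le> length s \<Longrightarrow>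
      finite (children A X s) \<and> card (children A X s) \<le> K * (length s + 1)"
    using assms(1) unfolding linearly_branching_def by blast
  obtain L M where LM: "\<And>s. M \<le> length s \<Longrightarrow>
      finite (children A Y s) \<and> card (children A Y s) \<le> L * (length s + 1)"
    using assms(2) unfolding linearly_branching_def by blast
  have Un: "children A (X \<union> Y) s = children A X s \<union> children A Y s" for s
    unfolding children_def tree_of_def by blast
  show ?thesis
  proof (rule linearly_branchingI[where N = "max N M" and K = "K + L"])
    fix s :: "nat list"
    assume "max N M \<le> length s"
    then show "finite (children A (X \<union> Y) s) \<and>
        card (children A (X \<union> Y) s) \<le> (K + L) * (length s + 1)"
      using KN[of s] LM[of s] card_Un_le[of "children A X s" "children A Y s"]
      by (simp add: Un add_mult_distrib)
  qed
qed

lemma PC_linearly_branching: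
  assumes "partition_scheme A" "X \<in> PC A"
  shows "linearly_branching A X"
proof -
  have "is_ideal {X. linearly_branching A X}"
    unfolding is_ideal_def mem_Collect_eq
    by (meson finite_linearly_branching[OF assms(1)] linearly_branching_subset linearly_branching_Un)
  moreover have "S0 A \<union> S1 A \<subseteq> {X. linearly_branching A X}"
    using S0_linearly_branching[OF assms(1)] S1_linearly_branching[OF assms(1)] by blast
  ultimately have "PC A \<subseteq> {X. linearly_branching A X}"
    unfolding PC_def generated_ideal_def by (intro hull_minimal)
  then show ?thesis using assms(2) by blast
qed

section \<open>Dead and alive nodes\<close>

text \<open>The complement is a greatest fixed point: \<open>s\<close> is alive iff it is the root
  of a subtree whose nodes all meet \<open>X\<close> and all have infinitely many children in that
  subtree.\<close>

inductive dead :: "(nat list \<Rightarrow> nat set) \<Rightarrow> nat set \<Rightarrow> nat list \<Rightarrow> bool" for A X where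
  empty: "X \<inter> A s = {} \<Longrightarrow> dead A X s"
| step: "finite F \<Longrightarrow> (\<And>n. n \<notin> F \<Longrightarrow> dead A X (s @ [n])) \<Longrightarrow> dead A X s"

lemma dead_cong:
  assumes "partition_scheme A" "dead A X s" "Y \<inter> A s = X \<inter> A s"
  shows "dead A Y s"
  using assms(2,3)
proof (induction rule: dead.induct)
  case (empty s)
  then show ?case by (auto intro: dead.empty)
next
  case (step F s)
  have "Y \<inter> A (s @ [n]) = X \<inter> A (s @ [n])" for n
    using step.prems partition_scheme_child_subset[OF assms(1), of s n] by blast
  then show ?case using step by (auto intro: dead.step)
qed

text \<open>This is partition regularity: one piece of any cut of an alive set stays alive at the
  same node. Two finite exceptional sets have a finite union, and where one set is absent the union
  agrees with the other.\<close>

lemma dead_Un: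
  assumes "partition_scheme A" "dead A X s" "dead A Y s"
  shows "dead A (X \<union> Y) s"
  using assms(2,3)
proof (induction rule: dead.induct)
  case (empty s)
  then show ?case using dead_cong[OF assms(1), of Y s "X \<union> Y"] by blast
next
  case (step F s)
  from step.prems show ?case
  proof (cases rule: dead.cases)
    case empty
    moreover have "dead A X s" using step.hyps by (rule dead.step)
    ultimately show ?thesis using dead_cong[OF assms(1), of X s "X \<union> Y"] by blast
  next
    case (step G)
    then show ?thesis
      using step.IH \<open>finite F\<close> dead.step[of "F \<union> G" A "X \<union> Y" s] by simp
  qed
qed

lemma alive_UNIV:
  assumes "partition_scheme A"
  shows "\<not> dead A UNIV s"
proof
  assume "dead A UNIV s"
  then show False
  proof (induction rule: dead.induct)
    case (empty s)
    then have "A s = {}" by simp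
    then show ?case using assms unfolding partition_scheme_def by (metis finite.emptyI)
  next
    case (step F s)
    then show ?case using ex_new_if_finite[OF infinite_UNIV_nat] by blast
  qed
qed

lemma alive_child:
  assumes "\<not> dead A X s"
  shows "\<exists>n\<ge>b. \<not> dead A X (s @ [n])"
  using dead.step[of "{..<b}" A X s] assms by (auto simp: not_less)

section \<open>Strategies from invariants\<close>

text \<open>This separates game bookkeeping from combinatorics: \<open>Inv\<close> ties a private
  state to the current board, while the winning condition is read off the transitions
  \<open>R\<close> alone.\<close>

lemma winning_strategy_from_invariant:
  fixes Inv :: "'q \<Rightarrow> nat set \<Rightarrow> bool" and R :: "'q \<Rightarrow> choice \<Rightarrow> 'q \<Rightarrow> bool"
  assumes init: "Inv start UNIV"
    and step: "\<And>q B C. Inv q B \<Longrightarrow> is_cut B C \<Longrightarrow>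
      \<exists>c q'. snd c \<in> C (fst c) \<and> Inv q' (C (fst c)) \<and> R q c q'"
    and win: "\<And>q c. q 0 = start \<Longrightarrow> (\<And>m. R (q m) (c m) (q (Suc m))) \<Longrightarrow> {snd (c j) | j. True} \<notin> I"
  shows "\<exists>\<sigma>. winning_strategy_II I \<sigma>"
proof -
  define good where "good = (\<lambda>q C p. snd (fst p) \<in> C (fst (fst p)) \<and>
    Inv (snd p) (C (fst (fst p))) \<and> R q (fst p) (snd p))"
  \<comment> \<open>Reply and next state are chosen together; the value is arbitrary if no good pair
    exists, as may happen after an illegal cut.\<close>
  define resp where "resp = (\<lambda>q C. SOME p. good q C p)"
  have good: "good q C (resp q C)" if "Inv q B" "is_cut B C" for q B C
    unfolding resp_def
  proof (rule someI_ex)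
    from step[OF that] obtain c q' where "good q C (c, q')"
      unfolding good_def by auto
    then show "\<exists>p. good q C p" by blast
  qed
  \<comment> \<open>The state is recovered by replaying the cuts of player I; the recorded replies
    are not consulted, since \<open>resp\<close> reproduces them.\<close>
  define state where "state = (\<lambda>h :: (cut \<times> choice) list. foldl (\<lambda>q r. snd (resp q (fst r))) start h)"
  define \<sigma> where "\<sigma> = (\<lambda>h C. fst (resp (state h) C))"
  have "winning_strategy_II I \<sigma>"
    unfolding winning_strategy_II_def
  proof (intro allI impI)
    fix C c
    assume follows: "follows_II \<sigma> C c"
    define q where "q = (\<lambda>m. state (map (\<lambda>k. (C k, c k)) [0..<m]))"
    have c: "c m = fst (resp (q m) (C m))" for m
      using follows unfolding follows_II_def \<sigma>_def q_def by blast
    have q_0: "q 0 = start" and q_Suc: "q (Suc m) = snd (resp (q m) (C m))" for m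
      by (simp_all add: q_def state_def)
    have inv: "Inv (q m) (board C c m)" if "\<forall>k<m. legal_I C c k" for m
      using that
    proof (induction m)
      case 0
      then show ?case using init q_0 by simp
    next
      case (Suc m)
      then have "good (q m) (C m) (resp (q m) (C m))"
        using good[of "q m" "board C c m" "C m"] by (simp add: legal_I_def)
      then show ?case by (simp add: good_def c q_Suc)
    qed
    have good_round: "good (q m) (C m) (c m, q (Suc m))" if "\<forall>k\<le>m. legal_I C c k" for m
      using good[of "q m" "board C c m" "C m"] inv[of m] that
      by (simp add: legal_I_def c q_Suc)
    show "(\<forall>m. (\<forall>k\<le>m. legal_I C c k) \<longrightarrow> legal_II C c m) \<and>
        ((\<forall>m. legal_I C c m) \<longrightarrow> {snd (c j) | j. True} \<notin> I)"
    proof (intro conjI allI impI)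
      fix m
      assume "\<forall>k\<le>m. legal_I C c k"
      then show "legal_II C c m"
        using good_round[of m] by (simp add: good_def legal_II_def)
    next
      assume "\<forall>m. legal_I C c m"
      then show "{snd (c j) | j. True} \<notin> I"
        using good_round by (intro win[of q c, OF q_0]) (simp add: good_def)
    qed
  qed
  then show ?thesis by blast
qed

section \<open>The strategy of player II\<close>

text \<open>
  A state \<open>(m, s, b)\<close> consists of the round \<open>m\<close>, the current node \<open>s\<close> and a bound \<open>b\<close> above all child
  indices used so far. The node has length \<open>i\<close> exactly in the rounds \<open>i\<^sup>3 \<le> m < (i + 1)\<^sup>3\<close>, whose
  number \<open>3 i (i + 1) + 1\<close> outgrows every multiple of \<open>i + 1\<close>.
\<close>

fun move :: "(nat list \<Rightarrow> nat set) \<Rightarrow> nat \<times> nat list \<times> nat \<Rightarrow> choice \<Rightarrow> nat \<times> nat list \<times> nat \<Rightarrow> bool"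
  where "move A (m, s, b) c (m', s', b') \<longleftrightarrow>
    (\<exists>n\<ge>b. snd c \<in> A (s @ [n]) \<and> m' = Suc m \<and> b' = Suc n \<and>
       s' = (if Suc m < (length s + 1) ^ 3 then s else s @ [n]))"

text \<open>A piece alive at \<open>s\<close> is alive at some child with index at least
  \<open>b\<close>. Picking a number below that child leaves both options open: staying at
  \<open>s\<close> and descending to the child.\<close>

lemma move_exists:
  assumes "partition_scheme A" "\<not> dead A B s" "is_cut B C"
  shows "\<exists>c s' b'. snd c \<in> C (fst c) \<and> \<not> dead A (C (fst c)) s' \<and> move A (m, s, b) c (Suc m, s', b')"
proof -
  obtain i where i: "\<not> dead A (C i) s"
    using assms dead_Un[OF assms(1)] unfolding is_cut_def by metis
  then obtain n where n: "n \<ge> b" "\<not> dead A (C i) (s @ [n])"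
    using alive_child by blast
  then obtain x where x: "x \<in> C i" "x \<in> A (s @ [n])"
    using dead.empty by blast
  show ?thesis
    using i n x
    by (intro exI[of _ "(i, x)"]
        exI[of _ "if Suc m < (length s + 1) ^ 3 then s else s @ [n]"] exI[of _ "Suc n"]) auto
qed

lemma move_not_linearly_branching:
  assumes init: "q 0 = (0, [], 0)"
    and run: "\<And>m. move A (q m) (c m) (q (Suc m))"
  shows "\<not> linearly_branching A {snd (c j) | j. True}"
proof
  let ?X = "{snd (c j) | j. True}"
  assume "linearly_branching A ?X"
  then obtain K N where KN: "\<And>s. N \<le> length s \<Longrightarrow>
      finite (children A ?X s) \<and> card (children A ?X s) \<le> K * (length s + 1)"
    unfolding linearly_branching_def by blast
  define s where "s = (\<lambda>m. fst (snd (q m)))"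
  define b where "b = (\<lambda>m. snd (snd (q m)))"
  have q: "q m = (m, s m, b m)" for m
  proof (induction m)
    case 0
    then show ?case using init by (simp add: s_def b_def)
  next
    case (Suc m)
    then have "move A (m, s m, b m) (c m) (q (Suc m))"
      using run[of m] by simp
    moreover obtain m' s' b' where q': "q (Suc m) = (m', s', b')"
      by (cases "q (Suc m)")
    ultimately have "m' = Suc m" by auto
    then show ?case by (simp add: q' s_def b_def)
  qed
  have "\<exists>n\<ge>b m. snd (c m) \<in> A (s m @ [n]) \<and> b (Suc m) = Suc n \<and>
      s (Suc m) = (if Suc m < (length (s m) + 1) ^ 3 then s m else s m @ [n])" for m
    using run[of m] unfolding q by simp
  then obtain n where n: "\<And>m. b m \<le> n m" "\<And>m. snd (c m) \<in> A (s m @ [n m])"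
      "\<And>m. b (Suc m) = Suc (n m)"
      "\<And>m. s (Suc m) = (if Suc m < (length (s m) + 1) ^ 3 then s m else s m @ [n m])"
    by metis
  \<comment> \<open>Each index is at least the bound set by its predecessor, so different rounds use
    different child indices.\<close>
  have "strict_mono n"
    using n(1,3) unfolding strict_mono_Suc_iff by (metis Suc_le_lessD)
  \<comment> \<open>The length of the node is the integer cube root of the round number.\<close>
  have phase: "length (s m) ^ 3 \<le> m \<and> m < (length (s m) + 1) ^ 3" for m
  proof (induction m)
    case 0
    then show ?case using init by (simp add: s_def)
  next
    case (Suc m)
    show ?case
    proof (cases "Suc m < (length (s m) + 1) ^ 3")
      case True
      then show ?thesis using Suc n(4)[of m] by simp
    next
      case False
      then have eq: "Suc m = (length (s m) + 1) ^ 3" using Suc by simp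
      have "length (s (Suc m)) = length (s m) + 1" using False n(4)[of m] by simp
      then show ?thesis using eq by (simp add: power_strict_mono)
    qed
  qed
  \<comment> \<open>\<open>N\<close> brings the node into the range of the assumed bound;
    \<open>K\<close> gives \<open>K * (i + 1) \<le> i * (i + 1)\<close>, below the
    \<open>3 * (i * (i + 1)) + 1\<close> children hit.\<close>
  define i where "i = max N K"
  \<comment> \<open>Round \<open>i ^ 3\<close> is the first one played at a node of length
    \<open>i\<close>.\<close>
  define t where "t = s (i ^ 3)"
  have t: "length t = i"
  proof -
    have "length t ^ 3 < (i + 1) ^ 3" "i ^ 3 < (length t + 1) ^ 3"
      using phase[of "i ^ 3"] power_strict_mono[of i "i + 1" 3] unfolding t_def
      by linarith+
    then have "length t < i + 1" "i < length t + 1"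
      using power_less_imp_less_base by blast+
    then show ?thesis by simp
  qed
  have s_eq: "i ^ 3 + d < (i + 1) ^ 3 \<Longrightarrow> s (i ^ 3 + d) = t" for d
  proof (induction d)
    case 0
    then show ?case by (simp add: t_def)
  next
    case (Suc d)
    then show ?case using n(4)[of "i ^ 3 + d"] t by simp
  qed
  have "n ` {i ^ 3..<(i + 1) ^ 3} \<subseteq> children A ?X t"
  proof
    fix k assume "k \<in> n ` {i ^ 3..<(i + 1) ^ 3}"
    then obtain m where m: "k = n m" "i ^ 3 \<le> m" "m < (i + 1) ^ 3" by auto
    then have "s m = t" using s_eq[of "m - i ^ 3"] by simp
    then have "snd (c m) \<in> ?X \<inter> A (t @ [k])" using n(2)[of m] m(1) by auto
    then show "k \<in> children A ?X t" unfolding children_def tree_of_def by blast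
  qed
  moreover have "finite (children A ?X t) \<and> card (children A ?X t) \<le> K * (i + 1)"
    using KN[of t] t by (simp add: i_def)
  ultimately have "card (n ` {i ^ 3..<(i + 1) ^ 3}) \<le> K * (i + 1)"
    using card_mono le_trans by blast
  moreover have "card (n ` {i ^ 3..<(i + 1) ^ 3}) = (i + 1) ^ 3 - i ^ 3"
    using \<open>strict_mono n\<close> by (simp add: card_image strict_mono_imp_inj_on inj_on_subset)
  moreover have "(i + 1) ^ 3 - i ^ 3 = 3 * (i * (i + 1)) + 1"
    by (simp add: power3_eq_cube algebra_simps)
  moreover have "K * (i + 1) \<le> i * (i + 1)"
    by (intro mult_right_mono) (simp_all add: i_def)
  ultimately show False by linarith
qed

theorem theorem1p1:
  fixes A :: "nat list \<Rightarrow> nat set"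
  assumes "partition_scheme A"
  shows "\<exists>\<sigma>. winning_strategy_II (PC A) \<sigma>"
proof (rule winning_strategy_from_invariant
    [where start = "(0, [], 0)" and Inv = "\<lambda>q B. \<not> dead A B (fst (snd q))" and R = "move A"])
  show "\<not> dead A UNIV (fst (snd (0, [], 0)))"
    using alive_UNIV[OF assms] by simp
  show "\<exists>c q'. snd c \<in> C (fst c) \<and> \<not> dead A (C (fst c)) (fst (snd q')) \<and> move A q c q'"
    if alive: "\<not> dead A B (fst (snd q))" and cut: "is_cut B C" for q B C
  proof -
    obtain m s b where q: "q = (m, s, b)" by (cases q)
    then have "\<not> dead A B s" using alive by simp
    from move_exists[OF assms this cut, of m b] show ?thesis
      unfolding q by (metis fst_conv snd_conv)
  qed
  show "{snd (c j) | j. True} \<notin> PC A"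
    if "q 0 = (0, [], 0)" "\<And>m. move A (q m) (c m) (q (Suc m))" for q c
    using move_not_linearly_branching[OF that] PC_linearly_branching[OF assms] by blast
qed

end
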